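(* Let $X$ be a real locally convex Hausdorff topological vector space, $\mathscr P_0(X^* )$ the set of nonempty weak*-closed convex subsets of $X^*$, $T$ a nonempty index set, $\emptyset\ne\mathcal U_t\subset\mathscr P_0(X^* )\times\mathbb R$ for each $t\in T$, $\mathfrak V:=\bigcup_{t\in T}\mathcal U_t$ and $\mathfrak U:=\prod_{t\in T}\mathcal U_t$. Assume that the system $\sigma_{\mathcal A}(x)\le b$ for all $(\mathcal A,b)\in\mathfrak V$ has a solution $x\in X$, and that for all $V=(V^1,V^2)\in\mathfrak V$ the set $V^1$ is weak*-compact. For $c\in X^*$ consider $$({\rm RSAP}_c)\quad\inf\{\langle c,x\rangle:\ x\in X,\ \sigma_{\mathcal A_t}(x)\le b_t\ \ \forall(\mathcal A_t,b_t)\in\mathcal U_t,\ \forall t\in T\},$$ and let $({\rm RSAD}^2_c)$ be the problem of computing the supremum of $$-\sum_{U\in\operatorname{supp}\lambda}\lambda_Uv_U^2$$ over all $t\in T$, all $\lambda\in\mathbb R_+^{(\mathfrak U)}$ and all families $(v_U)_{U\in\mathfrak U}$ with $v_U=(v_U^1,v_U^2)\in U_t$ for every $U\in\mathfrak U$, subject to $c=-\sum_{U\in\operatorname{supp}\lambda}\lambda_Uv_U^1$. Then the following statements are equivalent: $({\rm g}_2)$ $\mathcal R_2:=\bigcup_{t\in T}\operatorname{co}\operatorname{cone}\Big[\Big(\bigcup_{V\in\mathcal U_t}V\Big)\cup\{(0_{X^*},1)\}\Big]$ is a closed and convex subset of $X^*\times\mathbb R$; $({\rm h}_2)$ stable robust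 strong duality holds for the pair $({\rm RSAP}_c)-({\rm RSAD}^2_c)$, i.e. $\inf({\rm RSAP}_c)=\max({\rm RSAD}^2_c)$ for all $c\in X^*$.
   Context: $X^*$ is the topological dual of $X$ with the weak* topology; $X^*\times\mathbb R$ has the product topology. $\sigma_{\mathcal A}(x)=\sup_{x^*\in\mathcal A}\langle x^*,x\rangle$. A pair $V=(V^1,V^2)\in\mathscr P_0(X^* )\times\mathbb R$ is identified with the subset $V^1\times\{V^2\}$ of $X^*\times\mathbb R$; $U\in\mathfrak U$ is written $U=(U_t)_{t\in T}$ with $U_t=(U_t^1,U_t^2)\in\mathcal U_t$, so $v_U\in U_t$ means $v_U^1\in U_t^1$, $v_U^2=U_t^2$. $\mathbb R_+^{(\mathfrak U)}$ is the set of families of nonnegative reals indexed by $\mathfrak U$ with finite support; empty sums are zero, $\sup\emptyset=-\infty$. $\operatorname{cone}B=\{\lambda b:\lambda\ge0,b\in B\}$, $\operatorname{co}$ is the convex hull. "$\inf=\max$" means that the two optimal values are equal and that, when this common value is finite, the supremum in the dual problem is attained. *)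

theory Defs
  imports "HOL-Analysis.Analysis"
begin

section \<open>Locally convex Hausdorff spaces\<close>

class locally_convex_hausdorff = real_vector + topological_ab_group_add + t2_space +
  assumes tendsto_scaleR_Pair:
    "LIM p (nhds r \<times>\<^sub>F nhds a). fst p *\<^sub>R snd p :> nhds (r *\<^sub>R a)"
  and locally_convex_at_0:
    "open U \<Longrightarrow> 0 \<in> U \<Longrightarrow>
      \<exists>W. open W \<and> 0 \<in> W \<and> W \<subseteq> U \<and>
        (\<forall>x\<in>W. \<forall>y\<in>W. \<forall>u\<ge>0. \<forall>v\<ge>0. u + v = 1 \<longrightarrow> u *\<^sub>R x + v *\<^sub>R y \<in> W)"

text \<open>The last conjunct unfolds \<^term>\<open>convex W\<close>, since
  \<^const>\<open>convex\<close> cannot be used inside a class specification.\<close>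

lemma convex_neighbourhood_of_0:
  fixes U :: "'a :: locally_convex_hausdorff set"
  assumes "open U" "0 \<in> U"
  shows "\<exists>W. open W \<and> convex W \<and> 0 \<in> W \<and> W \<subseteq> U"
  using locally_convex_at_0[OF assms] unfolding convex_def by blast

instance real_normed_vector \<subseteq> locally_convex_hausdorff
proof
  fix r :: real and a :: 'a
  show "LIM p (nhds r \<times>\<^sub>F nhds a). fst p *\<^sub>R snd p :> nhds (r *\<^sub>R a)"
    by (intro tendsto_scaleR filterlim_fst filterlim_snd)
next
  fix U :: "'a set" assume "open U" "0 \<in> U"
  then obtain e where "e > 0" "ball 0 e \<subseteq> U"
    by (meson openE)
  then show "\<exists>W. open W \<and> 0 \<in> W \<and> W \<subseteq> U \<and>
      (\<forall>x\<in>W. \<forall>y\<in>W. \<forall>u\<ge>0. \<forall>v\<ge>0. u + v = 1 \<longrightarrow> u *\<^sub>R x + v *\<^sub>R y \<in> W)"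
    using convex_ball[of "0 :: 'a" e] unfolding convex_def
    by (intro exI[of _ "ball 0 e"]) auto
qed


section \<open>The topological dual with the weak* topology\<close>

typedef (overloaded) ('a :: "{real_vector, topological_space}") wdual =
  "{f :: 'a \<Rightarrow> real. linear f \<and> continuous_on UNIV f}"
  morphisms pairing Abs_wdual
  by (rule exI[of _ "\<lambda>_. 0"]) (auto simp: linear_iff)

setup_lifting type_definition_wdual

instantiation wdual :: ("{real_vector, topological_space}") real_vector
begin

lift_definition zero_wdual :: "'a wdual" is "\<lambda>_. 0"
  by (auto simp: linear_iff)

lift_definition plus_wdual :: "'a wdual \<Rightarrow> 'a wdual \<Rightarrow> 'a wdual" is "\<lambda>f g x. f x + g x"
  by (auto simp: linear_iff algebra_simps intro!: continuous_intros)

lift_definition minus_wdual :: "'a wdual \<Rightarrow> 'a wdual \<Rightarrow> 'a wdual" is "\<lambda>f g x. f x - g x"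
  by (auto simp: linear_iff algebra_simps intro!: continuous_intros)

lift_definition uminus_wdual :: "'a wdual \<Rightarrow> 'a wdual" is "\<lambda>f x. - f x"
  by (auto simp: linear_iff algebra_simps intro!: continuous_intros)

lift_definition scaleR_wdual :: "real \<Rightarrow> 'a wdual \<Rightarrow> 'a wdual" is "\<lambda>r f x. r * f x"
  by (auto simp: linear_iff algebra_simps intro!: continuous_intros)

instance
  by standard (transfer; auto simp: algebra_simps)+

end

text \<open>The weak* topology is the coarsest topology making every evaluation continuous.\<close>

instantiation wdual :: ("{real_vector, topological_space}") topological_space
begin

definition open_wdual :: "'a wdual set \<Rightarrow> bool" where
  "open_wdual = generate_topology {{f. pairing f x \<in> W} | x W. open W}"

instance
  by intro_classes (auto simp: open_wdual_def intro: generate_topology.intros)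

end


section \<open>Robust linear systems\<close>

definition support_fun :: "('a :: {real_vector, topological_space}) wdual set \<Rightarrow> 'a \<Rightarrow> ereal" where
  "support_fun A x = (SUP f\<in>A. ereal (pairing f x))"

definition P0 :: "('a :: {real_vector, topological_space}) wdual set set" where
  "P0 = {A. A \<noteq> {} \<and> closed A \<and> convex A}"

text \<open>The subset of the product space with which a pair \<open>V\<close> is identified.\<close>

definition pair_set :: "'b set \<times> real \<Rightarrow> ('b \<times> real) set" where
  "pair_set V = fst V \<times> {snd V}"

definition all_pairs :: "'t set \<Rightarrow> ('t \<Rightarrow> 'p set) \<Rightarrow> 'p set" where
  "all_pairs T \<U> = (\<Union>t\<in>T. \<U> t)"

definition selections :: "'t set \<Rightarrow> ('t \<Rightarrow> 'p set) \<Rightarrow> ('t \<Rightarrow> 'p) set" where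
  "selections T \<U> = (\<Pi>\<^sub>E t\<in>T. \<U> t)"

definition feasible ::
  "'t set \<Rightarrow> ('t \<Rightarrow> (('a :: {real_vector, topological_space}) wdual set \<times> real) set) \<Rightarrow> 'a set" where
  "feasible T \<U> = {x. \<forall>t\<in>T. \<forall>(A, b)\<in>\<U> t. support_fun A x \<le> ereal b}"

definition RSAP_value ::
  "'t set \<Rightarrow> ('t \<Rightarrow> (('a :: {real_vector, topological_space}) wdual set \<times> real) set) \<Rightarrow> 'a wdual \<Rightarrow> ereal" where
  "RSAP_value T \<U> c = (INF x\<in>feasible T \<U>. ereal (pairing c x))"

text \<open>Families of nonnegative reals indexed by \<open>I\<close> with finite support,
  represented as functions vanishing outside \<open>I\<close>.\<close>

definition supp :: "('i \<Rightarrow> real) \<Rightarrow> 'i set" where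
  "supp l = {i. l i \<noteq> 0}"

definition nonneg_finsupp :: "'i set \<Rightarrow> ('i \<Rightarrow> real) set" where
  "nonneg_finsupp I = {l. (\<forall>i. 0 \<le> l i) \<and> supp l \<subseteq> I \<and> finite (supp l)}"

definition RSAD2_feasible ::
  "'t set \<Rightarrow> ('t \<Rightarrow> (('a :: {real_vector, topological_space}) wdual set \<times> real) set) \<Rightarrow> 'a wdual \<Rightarrow>
   ('t \<times> (('t \<Rightarrow> 'a wdual set \<times> real) \<Rightarrow> real) \<times> (('t \<Rightarrow> 'a wdual set \<times> real) \<Rightarrow> 'a wdual \<times> real)) set" where
  "RSAD2_feasible T \<U> c =
     {(t, l, v). t \<in> T \<and> l \<in> nonneg_finsupp (selections T \<U>) \<and>
        v \<in> (\<Pi>\<^sub>E U\<in>selections T \<U>. pair_set (U t)) \<and>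
        c = - (\<Sum>U\<in>supp l. l U *\<^sub>R fst (v U))}"

definition RSAD2_objective :: "'t \<times> ('i \<Rightarrow> real) \<times> ('i \<Rightarrow> 'b \<times> real) \<Rightarrow> real" where
  "RSAD2_objective = (\<lambda>(t, l, v). - (\<Sum>U\<in>supp l. l U * snd (v U)))"

definition RSAD2_value ::
  "'t set \<Rightarrow> ('t \<Rightarrow> (('a :: {real_vector, topological_space}) wdual set \<times> real) set) \<Rightarrow> 'a wdual \<Rightarrow> ereal" where
  "RSAD2_value T \<U> c = (SUP d\<in>RSAD2_feasible T \<U> c. ereal (RSAD2_objective d))"

text \<open>The relation \<open>inf = max\<close>: equal values, and attainment in the dual problem if that value is finite.\<close>

definition strong_duality2 ::
  "'t set \<Rightarrow> ('t \<Rightarrow> (('a :: {real_vector, topological_space}) wdual set \<times> real) set) \<Rightarrow> 'a wdual \<Rightarrow> bool" where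
  "strong_duality2 T \<U> c \<longleftrightarrow>
     RSAP_value T \<U> c = RSAD2_value T \<U> c \<and>
     (\<bar>RSAP_value T \<U> c\<bar> \<noteq> \<infinity> \<longrightarrow>
        (\<exists>d\<in>RSAD2_feasible T \<U> c. ereal (RSAD2_objective d) = RSAD2_value T \<U> c))"

definition conic :: "'b :: real_vector set \<Rightarrow> 'b set" where
  "conic B = {r *\<^sub>R b | r b. 0 \<le> r \<and> b \<in> B}"

definition R2 ::
  "'t set \<Rightarrow> ('t \<Rightarrow> (('a :: {real_vector, topological_space}) wdual set \<times> real) set) \<Rightarrow> ('a wdual \<times> real) set" where
  "R2 T \<U> = (\<Union>t\<in>T. convex hull (conic ((\<Union>V\<in>\<U> t. pair_set V) \<union> {(0, 1)})))"

end

theory Submission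
  imports Defs
begin

text \<open>
  Write \<open>F\<close> for the feasible set and \<open>K\<close> for the set of all \<open>(f, s)\<close> with \<open>f \<le> s\<close> on \<open>F\<close>, a weak*
  closed convex cone containing \<open>\<R>\<^sub>2\<close>. By convexity of the sets \<open>V\<^sup>1\<close>, a pair \<open>(f, s)\<close> lies in \<open>\<R>\<^sub>2\<close>
  iff some dual feasible point for \<open>c = -f\<close> has value at least \<open>-s\<close>, while \<open>(f, s) \<in> K\<close> says that
  the primal value for \<open>c = -f\<close> is at least \<open>-s\<close>. Hence strong duality for all \<open>c\<close> amounts to
  \<open>\<R>\<^sub>2 = K\<close>. If \<open>\<R>\<^sub>2\<close> is closed and convex, a point of \<open>K\<close> outside \<open>\<R>\<^sub>2\<close> could be separated from
  the cone \<open>\<R>\<^sub>2\<close> by some \<open>(x, \<alpha>) \<in> X \<times> \<real>\<close> with \<open>\<alpha> \<le> 0\<close>, and either \<open>x / (-\<alpha>)\<close> or, when \<open>\<alpha> = 0\<close>, a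
  point of \<open>F\<close> moved far in direction \<open>x\<close> contradicts membership in \<open>K\<close>.
\<close>

section \<open>Separation by finitely many functionals\<close>

text \<open>Passage to the limit from the right at 0. It extracts the first-order condition
  satisfied by a nearest point.\<close>

lemma nonneg_of_small_perturbation:
  fixes A B :: real
  assumes "\<And>t. 0 < t \<Longrightarrow> t \<le> 1 \<Longrightarrow> 0 \<le> A + t * B"
  shows "0 \<le> A"
proof (rule tendsto_lowerbound)
  show "((\<lambda>t. A + t * B) \<longlongrightarrow> A) (at_right 0)"
    by (auto intro!: tendsto_eq_intros)
  show "\<forall>\<^sub>F t in at_right 0. 0 \<le> A + t * B"
    using assms by (auto simp: eventually_at_right_field intro!: exI[of _ 1])
qed simp

text \<open>The nearest point to \<open>b\<close> in the closure of the image of \<open>C\<close> under \<open>(\<phi> i)\<^sub>i\<^sub>\<in>\<^sub>I\<close>. The index set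
  cannot be turned into a Euclidean type, so the minimising sequence is shown to be
  Cauchy coordinatewise by the parallelogram law.\<close>

lemma finite_functionals_separation:
  fixes \<phi> :: "'i \<Rightarrow> 'v::real_vector \<Rightarrow> real"
  assumes I: "finite I" and lin: "\<And>i. i \<in> I \<Longrightarrow> linear (\<phi> i)"
    and C: "convex C" "C \<noteq> {}" and \<delta>: "0 < \<delta>"
    and far: "\<And>p. p \<in> C \<Longrightarrow> \<delta> \<le> (\<Sum>i\<in>I. (\<phi> i p - b i)\<^sup>2)"
  shows "\<exists>a. \<forall>p\<in>C. (\<Sum>i\<in>I. a i * \<phi> i p) + \<delta> \<le> (\<Sum>i\<in>I. a i * b i)"
proof -
  define D where "D p = (\<Sum>i\<in>I. (\<phi> i p - b i)\<^sup>2)" for p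
  define m where "m = (INF p\<in>C. D p)"
  have bdd: "bdd_below (D ` C)"
    using far unfolding D_def by (auto intro!: bdd_belowI2)
  have m_le: "m \<le> D p" if "p \<in> C" for p
    unfolding m_def by (rule cINF_lower[OF bdd that])
  have \<delta>_le: "\<delta> \<le> m"
    unfolding m_def using C(2) far by (intro cINF_greatest) (auto simp: D_def)
  have comb: "\<phi> i (u *\<^sub>R p + v *\<^sub>R q) = u * \<phi> i p + v * \<phi> i q" if "i \<in> I" for i u v p q
    using lin[OF that] by (simp add: linear_add linear_scale)
  have "\<exists>p\<in>C. D p < m + inverse (real (Suc k))" for k
    unfolding m_def using C(2) bdd
    by (subst cINF_less_iff[symmetric]) auto
  then obtain P where PC: "\<And>k. P k \<in> C" and PD: "\<And>k. D (P k) < m + inverse (real (Suc k))"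
    by metis
  \<comment> \<open>Parallelogram law at the midpoint \<open>r\<close> of \<open>p\<close> and
    \<open>q\<close>: as \<open>D r\<close> is at least \<open>m\<close>, two near-minimisers have
    nearly equal coordinates.\<close>
  have par: "(\<phi> i p - \<phi> i q)\<^sup>2 \<le> 2 * (D p - m) + 2 * (D q - m)"
    if pq: "p \<in> C" "q \<in> C" and i: "i \<in> I" for i p q
  proof -
    define r where "r = (1/2) *\<^sub>R p + (1/2) *\<^sub>R q"
    have "r \<in> C"
      unfolding r_def using C(1) pq by (auto simp: convex_def)
    have "(\<phi> i p - \<phi> i q)\<^sup>2 \<le> (\<Sum>i\<in>I. (\<phi> i p - \<phi> i q)\<^sup>2)"
      using I i by (intro member_le_sum) auto
    also have "\<dots> = (\<Sum>i\<in>I. 2 * (\<phi> i p - b i)\<^sup>2 + 2 * (\<phi> i q - b i)\<^sup>2 - 4 * (\<phi> i r - b i)\<^sup>2)"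
      unfolding r_def
      by (intro sum.cong refl) (simp add: comb power2_eq_square field_simps)
    also have "\<dots> = 2 * D p + 2 * D q - 4 * D r"
      by (simp add: D_def sum.distrib sum_subtractf sum_distrib_left)
    also have "\<dots> \<le> 2 * D p + 2 * D q - 4 * m"
      using m_le[OF \<open>r \<in> C\<close>] by simp
    finally show ?thesis by (simp add: algebra_simps)
  qed
  have "convergent (\<lambda>k. \<phi> i (P k))" if i: "i \<in> I" for i
  proof -
    have "Cauchy (\<lambda>k. \<phi> i (P k))"
    proof (rule metric_CauchyI)
      fix e :: real assume "0 < e"
      then have "0 < e\<^sup>2 / 4" by simp
      then obtain N where N: "inverse (real (Suc N)) < e\<^sup>2 / 4"
        using reals_Archimedean by blast
      have small: "D (P k) - m < e\<^sup>2 / 4" if "N \<le> k" for k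
      proof -
        have "inverse (real (Suc k)) \<le> inverse (real (Suc N))"
          using that by (intro le_imp_inverse_le) auto
        then show ?thesis using PD[of k] N by linarith
      qed
      have "dist (\<phi> i (P k)) (\<phi> i (P l)) < e" if "N \<le> k" "N \<le> l" for k l
      proof -
        have "2 * (D (P k) - m) + 2 * (D (P l) - m) < e\<^sup>2"
          using small[OF that(1)] small[OF that(2)] by (simp add: field_simps)
        with par[OF PC PC i] have "(\<phi> i (P k) - \<phi> i (P l))\<^sup>2 < e\<^sup>2"
          by (rule order_le_less_trans)
        then show ?thesis
          using \<open>0 < e\<close> abs_le_square_iff[of e "\<phi> i (P k) - \<phi> i (P l)"]
          by (auto simp: dist_real_def)
      qed
      then show "\<exists>M. \<forall>k\<ge>M. \<forall>l\<ge>M. dist (\<phi> i (P k)) (\<phi> i (P l)) < e" by blast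
    qed
    then show ?thesis by (rule Cauchy_convergent)
  qed
  then have "\<forall>i\<in>I. \<exists>L. (\<lambda>k. \<phi> i (P k)) \<longlonglongrightarrow> L"
    by (simp add: convergent_def)
  then obtain y where y: "\<And>i. i \<in> I \<Longrightarrow> (\<lambda>k. \<phi> i (P k)) \<longlonglongrightarrow> y i"
    by metis
  have "(\<lambda>k. D (P k)) \<longlonglongrightarrow> (\<Sum>i\<in>I. (y i - b i)\<^sup>2)"
    unfolding D_def by (intro tendsto_intros y)
  moreover have "(\<lambda>k. D (P k)) \<longlonglongrightarrow> m"
  proof (rule real_tendsto_sandwich[where f = "\<lambda>_. m"])
    show "(\<lambda>k. m + inverse (real (Suc k))) \<longlonglongrightarrow> m"
      using LIMSEQ_inverse_real_of_nat_add[of m] by simp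
    show "\<forall>\<^sub>F k in sequentially. D (P k) \<le> m + inverse (real (Suc k))"
      by (intro always_eventually allI less_imp_le PD)
    show "\<forall>\<^sub>F k in sequentially. m \<le> D (P k)"
      by (intro always_eventually allI m_le PC)
  qed simp
  ultimately have m_eq: "m = (\<Sum>i\<in>I. (y i - b i)\<^sup>2)"
    using LIMSEQ_unique by blast
  \<comment> \<open>The separating coefficients are the residual \<open>b - y\<close>. The gap
    equals \<open>m + A\<close>, where \<open>A\<close> is nonnegative because \<open>y\<close> is
    nearest to \<open>b\<close>.\<close>
  have "(\<Sum>i\<in>I. (b i - y i) * \<phi> i p) + \<delta> \<le> (\<Sum>i\<in>I. (b i - y i) * b i)" if p: "p \<in> C" for p
  proof -
    define A where "A = (\<Sum>i\<in>I. (y i - b i) * (\<phi> i p - y i))"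
    define B where "B = (\<Sum>i\<in>I. (\<phi> i p - y i)\<^sup>2)"
    \<comment> \<open>The segment from \<open>y\<close> to the image of \<open>p\<close> consists of
      limits of images of points of \<open>C\<close>, so \<open>m\<close> bounds the squared
      distance there too. Expanding in \<open>t\<close> and cancelling one factor \<open>t\<close>
      gives the claim.\<close>
    have "0 \<le> 2 * A + t * B" if t: "0 < t" "t \<le> 1" for t
    proof -
      have "m \<le> (\<Sum>i\<in>I. ((1 - t) * y i + t * \<phi> i p - b i)\<^sup>2)"
      proof (rule LIMSEQ_le_const)
        show "(\<lambda>k. D ((1 - t) *\<^sub>R P k + t *\<^sub>R p))
            \<longlonglongrightarrow> (\<Sum>i\<in>I. ((1 - t) * y i + t * \<phi> i p - b i)\<^sup>2)"
          unfolding D_def by (simp add: comb cong: sum.cong) (intro tendsto_intros y)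
        have "(1 - t) *\<^sub>R P k + t *\<^sub>R p \<in> C" for k
          using C(1) PC p t by (auto simp: convex_alt)
        then show "\<exists>N. \<forall>k\<ge>N. m \<le> D ((1 - t) *\<^sub>R P k + t *\<^sub>R p)"
          using m_le by blast
      qed
      also have "\<dots> = (\<Sum>i\<in>I. (y i - b i)\<^sup>2 + t * (2 * ((y i - b i) * (\<phi> i p - y i)))
                              + t * (t * (\<phi> i p - y i)\<^sup>2))"
        by (intro sum.cong refl) (simp add: power2_eq_square algebra_simps)
      also have "\<dots> = m + t * (2 * A + t * B)"
        by (simp add: m_eq A_def B_def sum.distrib sum_distrib_left distrib_left)
      finally show ?thesis
        using t by (simp add: zero_le_mult_iff)
    qed
    then have "0 \<le> 2 * A" by (rule nonneg_of_small_perturbation)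
    moreover have "(\<Sum>i\<in>I. (b i - y i) * b i) - (\<Sum>i\<in>I. (b i - y i) * \<phi> i p) = m + A"
      unfolding m_eq A_def sum.distrib[symmetric] sum_subtractf[symmetric]
      by (intro sum.cong refl) (simp add: power2_eq_square algebra_simps)
    ultimately show ?thesis using \<delta>_le by linarith
  qed
  then show ?thesis by (intro exI[of _ "\<lambda>i. b i - y i"]) blast
qed

section \<open>The weak* dual\<close>

lemma pairing_zero [simp]: "pairing 0 x = 0"
  and pairing_add [simp]: "pairing (f + g) x = pairing f x + pairing g x"
  and pairing_minus [simp]: "pairing (- f) x = - pairing f x"
  and pairing_scaleR [simp]: "pairing (r *\<^sub>R f) x = r * pairing f x"
  by (transfer; simp)+

lemma pairing_sum: "pairing (\<Sum>i\<in>I. f i) x = (\<Sum>i\<in>I. pairing (f i) x)"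
  by (induction I rule: infinite_finite_induct) auto

lemma linear_pairing: "linear (pairing f)"
  using pairing[of f] by blast

lemma continuous_on_pairing [continuous_intros]:
  fixes g :: "'b::topological_space \<Rightarrow> 'a::{real_vector, topological_space} wdual"
  assumes "continuous_on S g"
  shows "continuous_on S (\<lambda>z. pairing (g z) x)"
proof -
  have "continuous_on UNIV (\<lambda>f::'a wdual. pairing f x)"
    unfolding continuous_on_open_vimage[OF open_UNIV]
    by (auto simp: open_wdual_def vimage_def intro!: generate_topology.Basis)
  from continuous_on_compose2[OF this assms] show ?thesis by simp
qed

text \<open>Induction over the generated topology: intersections unite the finite sets and take the
  smaller radius. This reduces weak* separation to finitely many evaluations.\<close>

lemma wdual_neighbourhood:
  fixes A :: "'a::{real_vector, topological_space} wdual set"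
  assumes "open A" "f \<in> A"
  shows "\<exists>F e. finite F \<and> 0 < e \<and> {g. \<forall>x\<in>F. \<bar>pairing g x - pairing f x\<bar> < e} \<subseteq> A"
  using assms unfolding open_wdual_def
proof (induction A rule: generate_topology.induct)
  case UNIV
  then show ?case by (intro exI[of _ "{}"] exI[of _ 1]) auto
next
  case (Int A B)
  from Int.IH(1) Int.prems obtain F d where "finite F" "0 < d"
    "{g. \<forall>x\<in>F. \<bar>pairing g x - pairing f x\<bar> < d} \<subseteq> A"
    by blast
  moreover from Int.IH(2) Int.prems obtain G e where "finite G" "0 < e"
    "{g. \<forall>x\<in>G. \<bar>pairing g x - pairing f x\<bar> < e} \<subseteq> B"
    by blast
  ultimately show ?case
    by (intro exI[of _ "F \<union> G"] exI[of _ "min d e"] conjI) auto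
next
  case (UN K)
  then obtain k where "k \<in> K" "f \<in> k" by blast
  with UN.IH[of k] show ?case by (meson Union_upper order_trans)
next
  case (Basis s)
  then obtain x W where W: "s = {f. pairing f x \<in> W}" "open W" by blast
  with Basis(2) obtain e where "0 < e" "\<And>r. \<bar>r - pairing f x\<bar> < e \<Longrightarrow> r \<in> W"
    by (auto simp: open_dist dist_real_def)
  with W show ?case by (intro exI[of _ "{x}"] exI[of _ e]) auto
qed

text \<open>A basic neighbourhood of \<open>(f, s)\<close> missing \<open>C\<close> involves
  finitely many evaluations and the real coordinate, so finite separation applies. A linear
  combination of evaluations is again an evaluation, which puts the separating \<open>x\<close> in
  the original space.\<close>

lemma separation_wdual_real:
  fixes C :: "('a::{real_vector, topological_space} wdual \<times> real) set"
  assumes C: "closed C" "convex C" "C \<noteq> {}" and q: "(f, s) \<notin> C"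
  shows "\<exists>x \<alpha> \<delta>. 0 < \<delta> \<and> (\<forall>(g, r)\<in>C. pairing g x + \<alpha> * r + \<delta> \<le> pairing f x + \<alpha> * s)"
proof -
  have "open (- C)" "(f, s) \<in> - C" using C(1) q by auto
  then obtain A B where AB: "open A" "open B" "f \<in> A" "s \<in> B" "A \<times> B \<subseteq> - C"
    by (elim open_prod_elim) (auto simp: subset_iff)
  obtain F d where F: "finite F" "0 < d" "{g. \<forall>x\<in>F. \<bar>pairing g x - pairing f x\<bar> < d} \<subseteq> A"
    using wdual_neighbourhood[OF AB(1,3)] by blast
  obtain d' where d': "0 < d'" "\<And>r. \<bar>r - s\<bar> < d' \<Longrightarrow> r \<in> B"
    using AB(2,4) by (auto simp: open_dist dist_real_def)
  define e where "e = min d d'"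
  \<comment> \<open>An index \<open>(x, \<beta>)\<close> stands for the functional
    \<open>(g, r)\<close> to \<open>pairing g x + \<beta> * r\<close>; thus \<open>(0, 1)\<close>
    reads off the real coordinate.\<close>
  define \<phi> :: "'a \<times> real \<Rightarrow> 'a wdual \<times> real \<Rightarrow> real"
    where "\<phi> i p = pairing (fst p) (fst i) + snd i * snd p" for i p
  define I where "I = insert (0, 1) (F \<times> {0::real})"
  have I: "finite I" using F(1) by (simp add: I_def)
  have "0 < e" using F(2) d'(1) by (simp add: e_def)
  have far: "e\<^sup>2 \<le> (\<Sum>i\<in>I. (\<phi> i p - \<phi> i (f, s))\<^sup>2)" if "p \<in> C" for p
  proof -
    \<comment> \<open>A point of \<open>C\<close> leaves \<open>A\<close> or leaves
      \<open>B\<close>. Either way one functional detects it by at least \<open>e\<close>, and its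
      square alone gives the bound.\<close>
    obtain i where i: "i \<in> I" "e \<le> \<bar>\<phi> i p - \<phi> i (f, s)\<bar>"
    proof (cases "fst p \<in> A")
      case True
      then have "snd p \<notin> B" using AB(5) \<open>p \<in> C\<close> by (metis ComplD SigmaI prod.collapse subsetD)
      then have "d' \<le> \<bar>snd p - s\<bar>" using d'(2) not_less by blast
      then have "e \<le> \<bar>snd p - s\<bar>" by (simp add: e_def)
      then show thesis
        by (intro that[of "(0, 1)"]) (auto simp: I_def \<phi>_def linear_0[OF linear_pairing])
    next
      case False
      with F(3) have "\<not> (\<forall>x\<in>F. \<bar>pairing (fst p) x - pairing f x\<bar> < d)" by blast
      then obtain x where "x \<in> F" "d \<le> \<bar>pairing (fst p) x - pairing f x\<bar>"
        using not_less by blast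
      then show thesis
        by (intro that[of "(x, 0)"]) (auto simp: I_def \<phi>_def e_def)
    qed
    have "e\<^sup>2 \<le> (\<phi> i p - \<phi> i (f, s))\<^sup>2"
      using i(2) \<open>0 < e\<close> by (metis abs_le_square_iff abs_of_pos)
    also have "\<dots> \<le> (\<Sum>i\<in>I. (\<phi> i p - \<phi> i (f, s))\<^sup>2)"
      by (rule member_le_sum[OF i(1) _ I]) simp
    finally show ?thesis .
  qed
  have "linear (\<phi> i)" for i
    by (rule linearI) (auto simp: \<phi>_def algebra_simps)
  then have "\<exists>a. \<forall>p\<in>C. (\<Sum>i\<in>I. a i * \<phi> i p) + e\<^sup>2 \<le> (\<Sum>i\<in>I. a i * \<phi> i (f, s))"
    using finite_functionals_separation[OF I _ C(2,3), of \<phi> "e\<^sup>2" "\<lambda>i. \<phi> i (f, s)"] far \<open>0 < e\<close>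
    by simp
  then obtain a where a: "\<And>p. p \<in> C \<Longrightarrow>
      (\<Sum>i\<in>I. a i * \<phi> i p) + e\<^sup>2 \<le> (\<Sum>i\<in>I. a i * \<phi> i (f, s))"
    by blast
  have "(\<Sum>i\<in>I. a i * \<phi> i p)
      = pairing (fst p) (\<Sum>i\<in>I. a i *\<^sub>R fst i) + (\<Sum>i\<in>I. a i * snd i) * snd p" for p
    by (simp add: \<phi>_def linear_sum[OF linear_pairing] linear_scale[OF linear_pairing]
        sum_distrib_right sum.distrib distrib_left mult.assoc)
  with a \<open>0 < e\<close> show ?thesis
    by (intro exI[of _ "\<Sum>i\<in>I. a i *\<^sub>R fst i"] exI[of _ "\<Sum>i\<in>I. a i * snd i"] exI[of _ "e\<^sup>2"])
      (auto simp: split_beta)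
qed

text \<open>A positive value of the functional on the cone could be scaled to equal its value at
  \<open>(f, s)\<close>, against the strict margin.\<close>

lemma separation_wdual_real_cone:
  fixes C :: "('a::{real_vector, topological_space} wdual \<times> real) set"
  assumes C: "closed C" "convex C" "cone C" "C \<noteq> {}" and q: "(f, s) \<notin> C"
  shows "\<exists>x \<alpha>. (\<forall>(g, r)\<in>C. pairing g x + \<alpha> * r \<le> 0) \<and> 0 < pairing f x + \<alpha> * s"
proof -
  obtain x \<alpha> \<delta> where \<delta>: "0 < \<delta>"
    and sep: "\<And>g r. (g, r) \<in> C \<Longrightarrow> pairing g x + \<alpha> * r + \<delta> \<le> pairing f x + \<alpha> * s"
    using separation_wdual_real[OF C(1,2,4) q] by blast
  have pos: "0 < pairing f x + \<alpha> * s"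
    using sep[of 0 0] \<delta> cone_contains_0[OF C(3)] C(4) by (simp add: zero_prod_def)
  have "pairing g x + \<alpha> * r \<le> 0" if gr: "(g, r) \<in> C" for g r
  proof (rule ccontr)
    assume "\<not> ?thesis"
    then have gt: "0 < pairing g x + \<alpha> * r" by simp
    define k where "k = (pairing f x + \<alpha> * s) / (pairing g x + \<alpha> * r)"
    have "k *\<^sub>R (g, r) \<in> C"
      using C(3) gr gt pos unfolding cone_def k_def by (metis divide_pos_pos less_imp_le)
    from sep[OF this[unfolded scaleR_Pair]]
    have "k * (pairing g x + \<alpha> * r) + \<delta> \<le> pairing f x + \<alpha> * s"
      by (simp add: algebra_simps)
    moreover have "k * (pairing g x + \<alpha> * r) = pairing f x + \<alpha> * s"
      using gt by (simp add: k_def)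
    ultimately show False using \<delta> by linarith
  qed
  with pos show ?thesis by blast
qed

section \<open>The robust cone and the dual problem\<close>

lemma cone_conic: "cone (conic B)"
proof (unfold cone_def, intro ballI allI impI)
  fix x and c :: real assume "x \<in> conic B" "0 \<le> c"
  then obtain r b where "x = r *\<^sub>R b" "0 \<le> r" "b \<in> B" by (auto simp: conic_def)
  then show "c *\<^sub>R x \<in> conic B"
    using \<open>0 \<le> c\<close> unfolding conic_def by (auto intro!: exI[of _ "c * r"] exI[of _ b])
qed

lemma subset_conic: "B \<subseteq> conic B"
  by (auto simp: conic_def intro!: exI[of _ "1::real"])

lemma convex_cone_sum:
  assumes "convex K" "cone K" "K \<noteq> {}" "\<And>i. i \<in> I \<Longrightarrow> p i \<in> K" "\<And>i. i \<in> I \<Longrightarrow> 0 \<le> l i"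
  shows "(\<Sum>i\<in>I. l i *\<^sub>R p i) \<in> K"
  using assms(4,5)
proof (induction I rule: infinite_finite_induct)
  case (insert i I)
  then have "l i *\<^sub>R p i \<in> K" using assms(2) by (auto simp: cone_def)
  with insert show ?case using assms(1,2) convex_cone[of K] by auto
qed (use cone_contains_0[OF assms(2)] assms(3) in auto)

text \<open>Normalise the weights; if they sum to 0, both vanish and any point serves. Used to merge
  two vectors chosen from the same uncertainty set.\<close>

lemma convex_combination_rescaled:
  assumes "convex A" "p \<in> A" "q \<in> A" "0 \<le> \<alpha>" "0 \<le> \<beta>"
  shows "\<exists>r\<in>A. \<alpha> *\<^sub>R p + \<beta> *\<^sub>R q = (\<alpha> + \<beta>) *\<^sub>R r"
proof (cases "\<alpha> + \<beta> = 0")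
  case True
  with assms show ?thesis by (intro bexI[of _ p]) (auto simp: add_nonneg_eq_0_iff)
next
  case False
  then have "0 < \<alpha> + \<beta>" using assms by linarith
  have "(\<alpha> / (\<alpha> + \<beta>)) *\<^sub>R p + (\<beta> / (\<alpha> + \<beta>)) *\<^sub>R q \<in> A"
    using assms \<open>0 < \<alpha> + \<beta>\<close> by (intro convexD) (auto simp flip: add_divide_distrib)
  with False show ?thesis
    by (intro bexI[of _ "(\<alpha> / (\<alpha> + \<beta>)) *\<^sub>R p + (\<beta> / (\<alpha> + \<beta>)) *\<^sub>R q"])
      (auto simp: scaleR_add_right)
qed

text \<open>A supremum is at most \<open>b\<close> iff all its terms are. The constraints thus
  become linear inequalities indexed by generators of \<open>R2\<close>.\<close>

lemma feasible_iff:
  "x \<in> feasible T \<U> \<longleftrightarrow> (\<forall>t\<in>T. \<forall>V\<in>\<U> t. \<forall>p\<in>pair_set V. pairing (fst p) x \<le> snd p)"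
  by (auto simp: feasible_def support_fun_def pair_set_def SUP_le_iff split_beta)

locale robust_system =
  fixes T :: "'t set"
    and \<U> :: "'t \<Rightarrow> ('a::{real_vector, topological_space} wdual set \<times> real) set"
  assumes T_nonempty: "T \<noteq> {}"
    and U_nonempty: "t \<in> T \<Longrightarrow> \<U> t \<noteq> {}"
    and U_P0: "t \<in> T \<Longrightarrow> \<U> t \<subseteq> P0 \<times> UNIV"
    and feasible_nonempty: "feasible T \<U> \<noteq> {}"
begin

lemma selection_in: "U \<in> selections T \<U> \<Longrightarrow> t \<in> T \<Longrightarrow> U t \<in> \<U> t"
  by (auto simp: selections_def)

lemma pair_set_nonempty: "t \<in> T \<Longrightarrow> V \<in> \<U> t \<Longrightarrow> pair_set V \<noteq> {}"
  and convex_pair_set: "t \<in> T \<Longrightarrow> V \<in> \<U> t \<Longrightarrow> convex (pair_set V)"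
  using U_P0[of t] by (auto simp: P0_def pair_set_def intro!: convex_Times)

text \<open>Dual multipliers are indexed by whole selections; this lets one of them address a
  prescribed \<open>V\<close>.\<close>

lemma selection_through:
  assumes "t \<in> T" "V \<in> \<U> t"
  obtains U where "U \<in> selections T \<U>" "U t = V"
proof
  show "(\<lambda>t'\<in>T. if t' = t then V else SOME V. V \<in> \<U> t') \<in> selections T \<U>"
    using assms U_nonempty by (auto simp: selections_def some_in_eq)
qed (use assms in auto)

text \<open>Dual points carry a vector for every selection, even where the multiplier is zero; this
  supplies default values.\<close>

lemma uncertain_family_exists:
  assumes "t \<in> T"
  obtains v where "v \<in> (\<Pi>\<^sub>E U\<in>selections T \<U>. pair_set (U t))"
proof -
  have "(\<Pi>\<^sub>E U\<in>selections T \<U>. pair_set (U t)) \<noteq> {}"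
    using assms pair_set_nonempty selection_in by (auto simp: PiE_eq_empty_iff)
  with that show thesis by blast
qed

text \<open>The part of \<open>R2\<close> that will be shown to belong to \<open>t\<close>, in terms
  of dual points. The inequality in the last coordinate absorbs the generator
  \<open>(0, 1)\<close>.\<close>

definition dual_epi :: "'t \<Rightarrow> ('a wdual \<times> real) set" where
  "dual_epi t = {p. \<exists>l v. l \<in> nonneg_finsupp (selections T \<U>) \<and>
     v \<in> (\<Pi>\<^sub>E U\<in>selections T \<U>. pair_set (U t)) \<and>
     fst p = (\<Sum>U\<in>supp l. l U *\<^sub>R fst (v U)) \<and> (\<Sum>U\<in>supp l. l U * snd (v U)) \<le> snd p}"

text \<open>Two dual points may attach different vectors to the same selection \<open>U\<close>.
  Convexity of \<open>pair_set (U t)\<close> replaces them by one vector with the combined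
  weight.\<close>

lemma convex_dual_epi:
  assumes t: "t \<in> T"
  shows "convex (dual_epi t)"
proof (rule convexI)
  fix p q and \<alpha> \<beta> :: real
  assume pq: "p \<in> dual_epi t" "q \<in> dual_epi t" and \<alpha>\<beta>: "0 \<le> \<alpha>" "0 \<le> \<beta>" "\<alpha> + \<beta> = 1"
  let ?S = "selections T \<U>"
  obtain l v where l: "l \<in> nonneg_finsupp ?S" and v: "v \<in> (\<Pi>\<^sub>E U\<in>?S. pair_set (U t))"
    and p: "fst p = (\<Sum>U\<in>supp l. l U *\<^sub>R fst (v U))" "(\<Sum>U\<in>supp l. l U * snd (v U)) \<le> snd p"
    using pq(1) by (auto simp: dual_epi_def)
  obtain l' v' where l': "l' \<in> nonneg_finsupp ?S" and v': "v' \<in> (\<Pi>\<^sub>E U\<in>?S. pair_set (U t))"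
    and q: "fst q = (\<Sum>U\<in>supp l'. l' U *\<^sub>R fst (v' U))" "(\<Sum>U\<in>supp l'. l' U * snd (v' U)) \<le> snd q"
    using pq(2) by (auto simp: dual_epi_def)
  define k where "k U = \<alpha> * l U + \<beta> * l' U" for U
  have "\<exists>w\<in>pair_set (U t). (\<alpha> * l U) *\<^sub>R v U + (\<beta> * l' U) *\<^sub>R v' U = k U *\<^sub>R w"
    if U: "U \<in> ?S" for U
    unfolding k_def
    using convex_pair_set[OF t selection_in[OF U t]] v v' U l l' \<alpha>\<beta>
    by (intro convex_combination_rescaled) (auto simp: nonneg_finsupp_def)
  then obtain w where w: "\<And>U. U \<in> ?S \<Longrightarrow> w U \<in> pair_set (U t)"
    "\<And>U. U \<in> ?S \<Longrightarrow> (\<alpha> * l U) *\<^sub>R v U + (\<beta> * l' U) *\<^sub>R v' U = k U *\<^sub>R w U"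
    by metis
  \<comment> \<open>For \<alpha> = 0 or \<beta> = 0, \<open>supp k\<close> may be smaller than
    \<open>N\<close>; all sums are compared over \<open>N\<close>, where the extra terms
    vanish.\<close>
  define N where "N = supp l \<union> supp l'"
  have N: "finite N" "N \<subseteq> ?S" "supp k \<subseteq> N"
    using l l' by (auto simp: N_def nonneg_finsupp_def supp_def k_def)
  then have k: "k \<in> nonneg_finsupp ?S"
    using l l' \<alpha>\<beta> by (auto simp: nonneg_finsupp_def k_def intro: finite_subset)
  have sum_N: "(\<Sum>U\<in>supp m. m U *\<^sub>R z U) = (\<Sum>U\<in>N. m U *\<^sub>R z U)"
    if "supp m \<subseteq> N" for m and z :: "_ \<Rightarrow> 'a wdual \<times> real"
    using that N(1) by (intro sum.mono_neutral_left) (auto simp: supp_def)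
  have "(\<Sum>U\<in>supp k. k U *\<^sub>R restrict w ?S U) = (\<Sum>U\<in>N. k U *\<^sub>R restrict w ?S U)"
    by (rule sum_N[OF N(3)])
  also have "\<dots> = (\<Sum>U\<in>N. \<alpha> *\<^sub>R (l U *\<^sub>R v U) + \<beta> *\<^sub>R (l' U *\<^sub>R v' U))"
    using w(2) N(2) by (intro sum.cong refl) auto
  also have "\<dots> = \<alpha> *\<^sub>R (\<Sum>U\<in>N. l U *\<^sub>R v U) + \<beta> *\<^sub>R (\<Sum>U\<in>N. l' U *\<^sub>R v' U)"
    by (simp add: sum.distrib scaleR_sum_right)
  also have "\<dots> = \<alpha> *\<^sub>R (\<Sum>U\<in>supp l. l U *\<^sub>R v U) + \<beta> *\<^sub>R (\<Sum>U\<in>supp l'. l' U *\<^sub>R v' U)"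
    by (simp add: sum_N N_def)
  finally have eq: "(\<Sum>U\<in>supp k. k U *\<^sub>R restrict w ?S U)
      = \<alpha> *\<^sub>R (\<Sum>U\<in>supp l. l U *\<^sub>R v U) + \<beta> *\<^sub>R (\<Sum>U\<in>supp l'. l' U *\<^sub>R v' U)" .
  have "fst (\<alpha> *\<^sub>R p + \<beta> *\<^sub>R q) = (\<Sum>U\<in>supp k. k U *\<^sub>R fst (restrict w ?S U))"
    using arg_cong[OF eq, of fst] by (simp add: fst_sum p q)
  moreover have "(\<Sum>U\<in>supp k. k U * snd (restrict w ?S U)) \<le> snd (\<alpha> *\<^sub>R p + \<beta> *\<^sub>R q)"
    using arg_cong[OF eq, of snd] p(2) q(2) \<alpha>\<beta> by (simp add: snd_sum add_mono mult_left_mono)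
  moreover have "restrict w ?S \<in> (\<Pi>\<^sub>E U\<in>?S. pair_set (U t))"
    using w(1) by auto
  ultimately show "\<alpha> *\<^sub>R p + \<beta> *\<^sub>R q \<in> dual_epi t"
    unfolding dual_epi_def using k by blast
qed

text \<open>By convexity of \<open>dual_epi t\<close> only multiples of generators need checking,
  and each of these uses at most one nonzero multiplier.\<close>

lemma hull_subset_dual_epi:
  assumes t: "t \<in> T"
  shows "convex hull conic ((\<Union>V\<in>\<U> t. pair_set V) \<union> {(0, 1)}) \<subseteq> dual_epi t"
proof (rule hull_minimal)
  show "convex (dual_epi t)" by (rule convex_dual_epi[OF t])
  show "conic ((\<Union>V\<in>\<U> t. pair_set V) \<union> {(0, 1)}) \<subseteq> dual_epi t"
  proof
    fix p assume "p \<in> conic ((\<Union>V\<in>\<U> t. pair_set V) \<union> {(0, 1)})"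
    then obtain r b where p: "p = r *\<^sub>R b" "0 \<le> r" and b: "b \<in> (\<Union>V\<in>\<U> t. pair_set V) \<union> {(0, 1)}"
      unfolding conic_def by blast
    obtain v where v: "v \<in> (\<Pi>\<^sub>E U\<in>selections T \<U>. pair_set (U t))"
      using uncertain_family_exists[OF t] .
    show "p \<in> dual_epi t"
    proof (cases "b = (0, 1)")
      \<comment> \<open>Here all multipliers are zero and \<open>r\<close> is pure slack in the last
        coordinate.\<close>
      case True
      with p v show ?thesis
        unfolding dual_epi_def
        by (auto simp: nonneg_finsupp_def supp_def intro!: exI[of _ "\<lambda>_. 0"] exI[of _ v])
    next
      case False
      with b obtain V where V: "V \<in> \<U> t" "b \<in> pair_set V" by blast
      obtain U where U: "U \<in> selections T \<U>" "U t = V"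
        using selection_through[OF t V(1)] .
      define l where "l = (\<lambda>U'. if U' = U then r else 0)"
      \<comment> \<open>Only an inclusion: the support is empty when \<open>r = 0\<close>.\<close>
      have "supp l \<subseteq> {U}" by (auto simp: supp_def l_def)
      then have "(\<Sum>U'\<in>supp l. l U' *\<^sub>R (v(U := b)) U') = (\<Sum>U'\<in>{U}. l U' *\<^sub>R (v(U := b)) U')"
        by (intro sum.mono_neutral_left) (auto simp: supp_def)
      then have eq: "(\<Sum>U'\<in>supp l. l U' *\<^sub>R (v(U := b)) U') = p"
        by (simp add: l_def p)
      have "l \<in> nonneg_finsupp (selections T \<U>)"
        using \<open>supp l \<subseteq> {U}\<close> U p(2) by (auto simp: nonneg_finsupp_def l_def dest: finite_subset)
      moreover have "v(U := b) \<in> (\<Pi>\<^sub>E U\<in>selections T \<U>. pair_set (U t))"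
        using v V U by (auto simp: PiE_iff extensional_def)
      moreover have "fst p = (\<Sum>U'\<in>supp l. l U' *\<^sub>R fst ((v(U := b)) U'))"
        using arg_cong[OF eq, of fst] by (simp add: fst_sum)
      moreover have "(\<Sum>U'\<in>supp l. l U' * snd ((v(U := b)) U')) \<le> snd p"
        using arg_cong[OF eq, of snd] by (simp add: snd_sum)
      ultimately show ?thesis
        unfolding dual_epi_def by blast
    qed
  qed
qed

text \<open>The weighted sum lies in the convex cone, and the slack is a nonnegative multiple of
  \<open>(0, 1)\<close>.\<close>

lemma dual_epi_subset_hull:
  assumes t: "t \<in> T"
  shows "dual_epi t \<subseteq> convex hull conic ((\<Union>V\<in>\<U> t. pair_set V) \<union> {(0, 1)})"
    (is "_ \<subseteq> ?K")
proof
  fix p assume "p \<in> dual_epi t"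
  then obtain l v where l: "l \<in> nonneg_finsupp (selections T \<U>)"
    and v: "v \<in> (\<Pi>\<^sub>E U\<in>selections T \<U>. pair_set (U t))"
    and p: "fst p = (\<Sum>U\<in>supp l. l U *\<^sub>R fst (v U))" "(\<Sum>U\<in>supp l. l U * snd (v U)) \<le> snd p"
    by (auto simp: dual_epi_def)
  have cone: "cone ?K" by (intro cone_convex_hull cone_conic)
  have gen: "b \<in> ?K" if "b \<in> (\<Union>V\<in>\<U> t. pair_set V) \<union> {(0, 1)}" for b
    using that subset_conic hull_subset by (metis subsetD)
  have "(\<Sum>U\<in>supp l. l U *\<^sub>R v U) \<in> ?K"
  proof (rule convex_cone_sum[OF convex_convex_hull cone])
    fix U assume "U \<in> supp l"
    then have U: "U \<in> selections T \<U>" using l by (auto simp: nonneg_finsupp_def)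
    then have "v U \<in> pair_set (U t)" using v by auto
    with selection_in[OF U t] show "v U \<in> ?K" by (intro gen) auto
    show "0 \<le> l U" using l by (auto simp: nonneg_finsupp_def)
  qed (use gen[of "(0, 1)"] in auto)
  moreover have "(snd p - (\<Sum>U\<in>supp l. l U * snd (v U))) *\<^sub>R (0, 1) \<in> ?K"
    using cone gen[of "(0, 1)"] p(2) unfolding cone_def by (simp del: scaleR_Pair)
  ultimately have "(\<Sum>U\<in>supp l. l U *\<^sub>R v U)
      + (snd p - (\<Sum>U\<in>supp l. l U * snd (v U))) *\<^sub>R (0, 1) \<in> ?K"
    using convex_cone[of ?K] cone by auto
  also have "(\<Sum>U\<in>supp l. l U *\<^sub>R v U)
      + (snd p - (\<Sum>U\<in>supp l. l U * snd (v U))) *\<^sub>R (0, 1) = p"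
    by (rule prod_eqI) (simp_all add: fst_sum snd_sum p(1))
  finally show "p \<in> ?K" .
qed

lemma R2_eq_dual_epi: "R2 T \<U> = (\<Union>t\<in>T. dual_epi t)"
  unfolding R2_def using hull_subset_dual_epi dual_epi_subset_hull by blast

lemma mem_R2_iff:
  "(f, s) \<in> R2 T \<U> \<longleftrightarrow> (\<exists>d\<in>RSAD2_feasible T \<U> (- f). - s \<le> RSAD2_objective d)"
  unfolding R2_eq_dual_epi dual_epi_def RSAD2_feasible_def RSAD2_objective_def by auto

section \<open>Weak duality and the cone of valid inequalities\<close>

lemma weak_duality:
  assumes d: "d \<in> RSAD2_feasible T \<U> c" and x: "x \<in> feasible T \<U>"
  shows "RSAD2_objective d \<le> pairing c x"
proof -
  obtain t l v where d_eq: "d = (t, l, v)" and t: "t \<in> T"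
    and l: "l \<in> nonneg_finsupp (selections T \<U>)"
    and v: "v \<in> (\<Pi>\<^sub>E U\<in>selections T \<U>. pair_set (U t))"
    and c: "c = - (\<Sum>U\<in>supp l. l U *\<^sub>R fst (v U))"
    using d by (auto simp: RSAD2_feasible_def)
  have "(\<Sum>U\<in>supp l. l U * pairing (fst (v U)) x) \<le> (\<Sum>U\<in>supp l. l U * snd (v U))"
  proof (intro sum_mono mult_left_mono)
    fix U assume "U \<in> supp l"
    then have U: "U \<in> selections T \<U>" using l by (auto simp: nonneg_finsupp_def)
    then have "v U \<in> pair_set (U t)" using v by auto
    with x t selection_in[OF U t] show "pairing (fst (v U)) x \<le> snd (v U)"
      by (auto simp: feasible_iff)
    show "0 \<le> l U" using l by (auto simp: nonneg_finsupp_def)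
  qed
  then show ?thesis
    by (simp add: d_eq c RSAD2_objective_def pairing_sum)
qed

lemma RSAD2_le_RSAP: "RSAD2_value T \<U> c \<le> RSAP_value T \<U> c"
  unfolding RSAD2_value_def RSAP_value_def
  by (intro SUP_least INF_greatest) (simp add: weak_duality)

text \<open>The set \<open>K\<close> of the introduction: the epigraph of the support function of
  the feasible set.\<close>

definition consequence_cone :: "('a wdual \<times> real) set" where
  "consequence_cone = {(f, s). \<forall>x\<in>feasible T \<U>. pairing f x \<le> s}"

lemma R2_subset: "R2 T \<U> \<subseteq> consequence_cone"
proof
  fix p assume p: "p \<in> R2 T \<U>"
  obtain f s where fs: "p = (f, s)" by (cases p)
  then obtain d where "d \<in> RSAD2_feasible T \<U> (- f)" "- s \<le> RSAD2_objective d"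
    using p mem_R2_iff by blast
  with weak_duality show "p \<in> consequence_cone"
    by (fastforce simp: consequence_cone_def fs)
qed

lemma closed_consequence_cone: "closed consequence_cone"
proof -
  have "consequence_cone = (\<Inter>x\<in>feasible T \<U>. {p. pairing (fst p) x \<le> snd p})"
    by (auto simp: consequence_cone_def)
  then show ?thesis
    by (auto intro!: closed_INT closed_Collect_le continuous_intros)
qed

lemma convex_consequence_cone: "convex consequence_cone"
  by (rule convexI) (auto simp: consequence_cone_def intro!: add_mono mult_left_mono)

text \<open>Unlike convexity, being a cone passes from the members to their union.\<close>

lemma cone_R2: "cone (R2 T \<U>)"
  using cone_convex_hull[OF cone_conic] unfolding R2_def cone_def by blast

lemma generators_in_R2:
  assumes "t \<in> T" "b \<in> (\<Union>V\<in>\<U> t. pair_set V) \<union> {(0, 1)}"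
  shows "b \<in> R2 T \<U>"
proof -
  have "b \<in> convex hull conic ((\<Union>V\<in>\<U> t. pair_set V) \<union> {(0, 1)})"
    using assms(2) subset_conic hull_subset by (metis subsetD)
  then show ?thesis unfolding R2_def using assms(1) by blast
qed

text \<open>A robust Farkas lemma: the separating functional is turned into a feasible point that
  violates the given inequality.\<close>

lemma farkas:
  assumes "closed (R2 T \<U>)" "convex (R2 T \<U>)"
  shows "consequence_cone \<subseteq> R2 T \<U>"
proof
  fix p assume p: "p \<in> consequence_cone"
  obtain f s where fs: "p = (f, s)" by (cases p)
  have le: "pairing f x \<le> s" if "x \<in> feasible T \<U>" for x
    using p that by (auto simp: consequence_cone_def fs)
  show "p \<in> R2 T \<U>"
  proof (rule ccontr)
    assume nin: "p \<notin> R2 T \<U>"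
    obtain t where t: "t \<in> T" using T_nonempty by blast
    have vertical: "(0, 1) \<in> R2 T \<U>" using generators_in_R2[OF t] by blast
    then have "R2 T \<U> \<noteq> {}" by blast
    then obtain x \<alpha> where sep: "\<And>g r. (g, r) \<in> R2 T \<U> \<Longrightarrow> pairing g x + \<alpha> * r \<le> 0"
      and pos: "0 < pairing f x + \<alpha> * s"
      using separation_wdual_real_cone[OF assms cone_R2 _ nin[unfolded fs]] by blast
    have gen: "pairing (fst b) x + \<alpha> * snd b \<le> 0"
      if "t \<in> T" "V \<in> \<U> t" "b \<in> pair_set V" for t V b
      using sep[of "fst b" "snd b"] generators_in_R2[of t b] that by auto
    have "\<alpha> \<le> 0" using sep[OF vertical] by simp
    show False
    proof (cases "\<alpha> = 0")
      \<comment> \<open>Now \<open>x\<close> is a recession direction of the feasible set along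
        which \<open>f\<close> increases; \<open>k\<close> is chosen to overshoot
        \<open>s\<close>.\<close>
      case True
      obtain x0 where x0: "x0 \<in> feasible T \<U>" using feasible_nonempty by blast
      define k where "k = (\<bar>s - pairing f x0\<bar> + 1) / pairing f x"
      have "0 < pairing f x" using pos True by simp
      then have "0 \<le> k" by (simp add: k_def)
      have "x0 + k *\<^sub>R x \<in> feasible T \<U>"
        unfolding feasible_iff
      proof (intro ballI)
        fix t V b assume *: "t \<in> T" "V \<in> \<U> t" "b \<in> pair_set V"
        then have "pairing (fst b) x0 \<le> snd b" using x0 by (auto simp: feasible_iff)
        moreover have "k * pairing (fst b) x \<le> 0"
          using gen[OF *] True \<open>0 \<le> k\<close> by (simp add: mult_nonneg_nonpos)
        ultimately show "pairing (fst b) (x0 + k *\<^sub>R x) \<le> snd b"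
          by (simp add: linear_add[OF linear_pairing] linear_scale[OF linear_pairing])
      qed
      from le[OF this] have "pairing f x0 + k * pairing f x \<le> s"
        by (simp add: linear_add[OF linear_pairing] linear_scale[OF linear_pairing])
      moreover have "k * pairing f x = \<bar>s - pairing f x0\<bar> + 1"
        using \<open>0 < pairing f x\<close> by (simp add: k_def)
      ultimately show False by linarith
    next
      case False
      with \<open>\<alpha> \<le> 0\<close> have \<alpha>: "\<alpha> < 0" by simp
      \<comment> \<open>Division by \<open>- \<alpha>\<close> turns separation on the generators
        into the constraints at the rescaled point, and positivity at \<open>(f, s)\<close> into a
        violated inequality.\<close>
      have scale: "pairing g ((1 / (- \<alpha>)) *\<^sub>R x) \<le> r \<longleftrightarrow> pairing g x + \<alpha> * r \<le> 0" for g r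
        using \<alpha> by (simp add: linear_scale[OF linear_pairing] linear_neg[OF linear_pairing] field_simps)
          (safe; linarith)
      have "(1 / (- \<alpha>)) *\<^sub>R x \<in> feasible T \<U>"
        unfolding feasible_iff scale using gen by blast
      from le[OF this] pos show False unfolding scale by linarith
    qed
  qed
qed

lemma R2_closed_convex_iff: "closed (R2 T \<U>) \<and> convex (R2 T \<U>) \<longleftrightarrow> R2 T \<U> = consequence_cone"
  using farkas R2_subset closed_consequence_cone convex_consequence_cone by auto

section \<open>Strong duality as an inclusion of cones\<close>

lemma mem_consequence_cone_iff: "(- c, - r) \<in> consequence_cone \<longleftrightarrow> ereal r \<le> RSAP_value T \<U> c"
  by (auto simp: consequence_cone_def RSAP_value_def le_INF_iff)

lemma RSAP_value_less_PInf: "RSAP_value T \<U> c < \<infinity>"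
proof -
  obtain x where "x \<in> feasible T \<U>" using feasible_nonempty by blast
  then have "RSAP_value T \<U> c \<le> ereal (pairing c x)"
    unfolding RSAP_value_def by (rule INF_lower)
  then show ?thesis by (rule le_less_trans) simp
qed

text \<open>Over \<open>- c\<close>, the consequence cone records real lower bounds of the primal
  value, and \<open>R2\<close> those reached by some dual point. Attainment is therefore part of the
  inclusion.\<close>

lemma strong_duality2_iff:
  "strong_duality2 T \<U> c \<longleftrightarrow> (\<forall>r. (- c, - r) \<in> consequence_cone \<longrightarrow> (- c, - r) \<in> R2 T \<U>)"
proof
  assume sd: "strong_duality2 T \<U> c"
  show "\<forall>r. (- c, - r) \<in> consequence_cone \<longrightarrow> (- c, - r) \<in> R2 T \<U>"
  proof (intro allI impI)
    fix r assume "(- c, - r) \<in> consequence_cone"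
    then have r: "ereal r \<le> RSAP_value T \<U> c" by (simp add: mem_consequence_cone_iff)
    then have "\<bar>RSAP_value T \<U> c\<bar> \<noteq> \<infinity>" using RSAP_value_less_PInf[of c] by auto
    then obtain d where "d \<in> RSAD2_feasible T \<U> c" "ereal (RSAD2_objective d) = RSAP_value T \<U> c"
      using sd unfolding strong_duality2_def by metis
    with r show "(- c, - r) \<in> R2 T \<U>"
      unfolding mem_R2_iff by (metis ereal_less_eq(3) minus_minus)
  qed
next
  assume sub: "\<forall>r. (- c, - r) \<in> consequence_cone \<longrightarrow> (- c, - r) \<in> R2 T \<U>"
  show "strong_duality2 T \<U> c"
  proof (cases "RSAP_value T \<U> c")
    case (real m)
    \<comment> \<open>The finite optimal value is its own best lower bound, so membership at
      \<open>m\<close> yields a dual maximiser.\<close>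
    then have "(- c, - m) \<in> R2 T \<U>" using sub by (simp add: mem_consequence_cone_iff)
    then obtain d where d: "d \<in> RSAD2_feasible T \<U> c" "m \<le> RSAD2_objective d"
      unfolding mem_R2_iff by auto
    have "ereal (RSAD2_objective d) \<le> RSAD2_value T \<U> c"
      unfolding RSAD2_value_def using d(1) by (rule SUP_upper)
    moreover have "ereal m \<le> ereal (RSAD2_objective d)" using d(2) by simp
    moreover have "RSAD2_value T \<U> c \<le> ereal m" using RSAD2_le_RSAP[of c] real by simp
    ultimately have "ereal (RSAD2_objective d) = RSAD2_value T \<U> c" "RSAD2_value T \<U> c = ereal m"
      by (meson order_antisym order_trans)+
    with d(1) real show ?thesis unfolding strong_duality2_def by auto
  next
    case PInf
    then show ?thesis using RSAP_value_less_PInf[of c] by simp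
  next
    \<comment> \<open>Weak duality forces the dual value down to minus infinity, where no attainment
      is asked.\<close>
    case MInf
    then show ?thesis using RSAD2_le_RSAP[of c] by (simp add: strong_duality2_def)
  qed
qed

theorem stable_strong_duality:
  "closed (R2 T \<U>) \<and> convex (R2 T \<U>) \<longleftrightarrow> (\<forall>c. strong_duality2 T \<U> c)"
proof -
  \<comment> \<open>As \<open>c\<close> and \<open>r\<close> vary, \<open>(- c, - r)\<close> runs
    through the whole product space.\<close>
  have "(\<forall>c. strong_duality2 T \<U> c) \<longleftrightarrow> consequence_cone \<subseteq> R2 T \<U>"
    unfolding strong_duality2_iff subset_iff split_paired_All by (metis minus_minus)
  with R2_subset show ?thesis unfolding R2_closed_convex_iff by blast
qed

end

theorem corollary6p2:
  fixes T :: "'t set"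
    and \<U> :: "'t \<Rightarrow> (('a :: locally_convex_hausdorff) wdual set \<times> real) set"
  assumes "T \<noteq> {}"
    and "\<And>t. t \<in> T \<Longrightarrow> \<U> t \<noteq> {}"
    and "\<And>t. t \<in> T \<Longrightarrow> \<U> t \<subseteq> P0 \<times> UNIV"
    and "\<exists>x. \<forall>(A, b)\<in>all_pairs T \<U>. support_fun A x \<le> ereal b"
    and "\<forall>V\<in>all_pairs T \<U>. compact (fst V)"
  shows "(closed (R2 T \<U>) \<and> convex (R2 T \<U>)) \<longleftrightarrow> (\<forall>c. strong_duality2 T \<U> c)"
proof -
  have "feasible T \<U> \<noteq> {}"
    using assms(4) by (auto simp: feasible_def all_pairs_def)
  then interpret robust_system T \<U>
    using assms(1-3) by unfold_locales auto
  show ?thesis by (rule stable_strong_duality)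
qed

end
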